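(* Let $1\le k\le n$. Then $$LS_{n,k}(123)=\sum_{L}\Bigl(\prod_{g=1}^{n-k}(k-l_g+g)\Bigr)q^{\binom{k}{2}+\sum_{l\in L}(l-1)},$$ where the sum is over all subsets $L=\{l_1,l_2,\dots,l_{n-k}\}$ of $[k]$ (of size $n-k$) with $l_1>l_2>\cdots>l_{n-k}$.
   Context: A set partition $\pi=B_1/B_2/\cdots/B_k$ of $[n]=\{1,\dots,n\}$ is written with its blocks ordered so that $\min B_1<\min B_2<\cdots<\min B_k$. For $S\subseteq[n]$, restrict $\pi$ to $S$ by taking the nonempty intersections $B_i\cap S$, and standardize by replacing the smallest element of $S$ by $1$, the second smallest by $2$, etc. The partition $\pi$ contains a partition $\omega$ if the standardized restriction to some $S$ equals $\omega$; otherwise $\pi$ avoids $\omega$. $\Pi_{n,k}(\omega)$ is the set of partitions of $[n]$ with exactly $k$ blocks that avoid $\omega$. Here $123$ denotes the one-block partition $\{\{1,2,3\}\}$ of $[3]$. The restricted growth function (RGF) of $\pi$ is the word $w(\pi)=a_1\cdots a_n$ with $a_i=j$ iff $i\in B_j$. For a word $w=a_1\cdots a_n$ put $ls(a_j)=\#\{a_i: i<j,\ a_i<a_j\}$ (the cardinality of a set of values, so distinct letters are counted once), $ls(w)=\sum_j ls(a_j)$, and $ls(\pi)=ls(w(\pi))$. $LS_{n,k}(\omega)=LS_{n,k}(\omega;q)=\sum_{\pi\in\Pi_{n,k}(\omega)}q^{ls(\pi)}$. *)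

theory Defs
  imports "HOL-Library.Disjoint_Sets" "HOL-Computational_Algebra.Polynomial"
begin

definition std :: "nat set \<Rightarrow> nat \<Rightarrow> nat" where
  "std S x = card {y \<in> S. y \<le> x}"

definition restrict_std :: "nat set set \<Rightarrow> nat set \<Rightarrow> nat set set" where
  "restrict_std P S = (\<lambda>B. std S ` B) ` ((\<lambda>B. B \<inter> S) ` P - {{}})"

text \<open>A set partition is represented by its set of blocks, so the ground set of \<open>P\<close> is \<open>\<Union>P\<close>.\<close>

definition contains :: "nat set set \<Rightarrow> nat set set \<Rightarrow> bool" where
  "contains P Q \<longleftrightarrow> (\<exists>S \<subseteq> \<Union>P. restrict_std P S = Q)"

definition avoiding :: "nat \<Rightarrow> nat \<Rightarrow> nat set set \<Rightarrow> nat set set set" where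
  "avoiding n k Q = {P. partition_on {1..n} P \<and> card P = k \<and> \<not> contains P Q}"

text \<open>\<open>nth_block P j\<close> is the block \<open>B\<^sub>j\<close>, with indices starting at 1, when the blocks are
  listed in increasing order of their minima.\<close>

definition nth_block :: "nat set set \<Rightarrow> nat \<Rightarrow> nat set" where
  "nth_block P j = sorted_key_list_of_set Min P ! (j - 1)"

definition rgf :: "nat \<Rightarrow> nat set set \<Rightarrow> nat list" where
  "rgf n P = map (\<lambda>i. THE j. j \<in> {1..card P} \<and> i \<in> nth_block P j) [1..<Suc n]"

definition ls_word :: "nat list \<Rightarrow> nat" where
  "ls_word w = (\<Sum>j<length w. card {w ! i | i. i < j \<and> w ! i < w ! j})"

definition LS :: "nat \<Rightarrow> nat \<Rightarrow> nat set set \<Rightarrow> int poly" where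
  "LS n k Q = (\<Sum>P\<in>avoiding n k Q. monom 1 (ls_word (rgf n P)))"

text \<open>The \<open>g\<close>-th largest element of \<open>L\<close>, with \<open>g\<close> starting at 1.\<close>

definition nth_largest :: "nat set \<Rightarrow> nat \<Rightarrow> nat" where
  "nth_largest L g = rev (sorted_list_of_set L) ! (g - 1)"

end

theory Submission
  imports Defs
begin

text \<open>Taking restricted growth functions turns partitions avoiding \<open>123\<close> into words in which every
  letter of \<open>{1..k}\<close> occurs once or twice. In such a word all letters below \<open>a\<close> precede each
  occurrence of \<open>a\<close>, so the statistic is the sum of \<open>a - 1\<close> over all letters and depends only on
  the set \<open>L\<close> of doubled letters. Deleting the last letter, which is either a first and only \<open>k\<close>
  or the second copy of some \<open>l \<in> L\<close>, gives \<open>F k L = F (k - 1) L + (\<Sum>l\<in>L. F k (L - {l}))\<close> for the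
  number \<open>F k L\<close> of words; the product over \<open>L\<close> satisfies the same recursion, by induction on
  removing the least element of \<open>L\<close>.\<close>

section \<open>Counting words with prescribed doubled letters\<close>

text \<open>Restricted growth in the form "all smaller letters have occurred before". For words with
  alphabet \<open>{1..k}\<close> this is equivalent to bounding each letter by one more than the
  maximum of its predecessors, and it gives both the \<open>ls\<close> value of a letter and the
  order of the block minima directly.\<close>

definition rgf_words :: "nat \<Rightarrow> nat \<Rightarrow> nat list set" where
  "rgf_words n k =
    {w. length w = n \<and> set w = {1..k} \<and> (\<forall>i<n. {1..<w ! i} \<subseteq> set (take i w))}"

definition doubles :: "'a list \<Rightarrow> 'a set" where
  "doubles w = {a. count_list w a = 2}"

definition rgf_words_doubles :: "nat \<Rightarrow> nat \<Rightarrow> nat set \<Rightarrow> nat list set" where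
  "rgf_words_doubles n k L =
    {w \<in> rgf_words n k. (\<forall>a. count_list w a \<le> 2) \<and> doubles w = L}"

lemma finite_rgf_words: "finite (rgf_words n k)"
  by (rule finite_subset[OF _ finite_lists_length_eq[of "{1..k}" n]])
    (auto simp: rgf_words_def)

lemma finite_rgf_words_doubles: "finite (rgf_words_doubles n k L)"
  using finite_rgf_words[of n k] by (simp add: rgf_words_doubles_def)

section \<open>Appending and deleting the last letter\<close>

lemma rgf_words_snocI:
  assumes "w \<in> rgf_words n k" "set (w @ [a]) = {1..k'}" "{1..<a} \<subseteq> set w"
  shows "w @ [a] \<in> rgf_words (Suc n) k'"
  using assms by (auto simp: rgf_words_def nth_append less_Suc_eq)

text \<open>If the last letter \<open>a\<close> has occurred before, deleting it keeps the alphabet.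
  If it is new, it must be \<open>k\<close>: an earlier \<open>k\<close> with \<open>a < k\<close>
  would have required an \<open>a\<close> before it.\<close>

lemma rgf_words_snocD:
  assumes "w @ [a] \<in> rgf_words (Suc n) k"
  shows "a = k \<and> 0 < k \<and> w \<in> rgf_words n (k - 1) \<or> a \<in> {1..k} \<and> w \<in> rgf_words n k"
proof -
  have len: "length w = n" and set: "insert a (set w) = {1..k}"
    using assms by (auto simp: rgf_words_def)
  have rg: "{1..<w ! i} \<subseteq> set (take i w)" if "i < n" for i
    using assms that len unfolding rgf_words_def
    by (auto simp: nth_append dest!: spec[where x = i])
  have a: "a \<in> {1..k}" using set by blast
  show ?thesis
  proof (cases "a \<in> set w")
    case True
    then have "set w = {1..k}" using set by (simp add: insert_absorb)
    then show ?thesis using len rg a by (simp add: rgf_words_def)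
  next
    case False
    have "\<not> a < k"
    proof
      assume "a < k"
      then have "k \<in> set w" using set a by auto
      then obtain i where "i < n" "w ! i = k" using len by (auto simp: in_set_conv_nth)
      then have "a \<in> set (take i w)" using rg[of i] a \<open>a < k\<close> by auto
      then show False using False by (meson in_set_takeD)
    qed
    then have "a = k" using a by simp
    then have "set w = {1..k} - {k}" using set False by auto
    also have "\<dots> = {1..k - 1}" by auto
    finally show ?thesis using len rg a \<open>a = k\<close> by (auto simp: rgf_words_def)
  qed
qed

lemma doubles_subset: "doubles w \<subseteq> set w"
  by (auto simp: doubles_def) (metis count_notin zero_neq_numeral)

lemma rgf_words_doubles_empty:
  assumes "\<not> L \<subseteq> {1..k}"
  shows "rgf_words_doubles n k L = {}"
proof (rule equals0I)
  fix w assume "w \<in> rgf_words_doubles n k L"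
  then show False
    using assms doubles_subset[of w] by (simp add: rgf_words_doubles_def rgf_words_def)
qed

lemma rgf_words_doubles_Suc:
  assumes "0 < k" "L \<subseteq> {1..k}"
  shows "rgf_words_doubles (Suc n) k L =
    (\<lambda>w. w @ [k]) ` rgf_words_doubles n (k - 1) L \<union>
    (\<Union>l\<in>L. (\<lambda>w. w @ [l]) ` rgf_words_doubles n k (L - {l}))" (is "?A = ?B \<union> ?C")
proof (intro equalityI subsetI)
  fix u assume u: "u \<in> ?A"
  then have "length u = Suc n" by (auto simp: rgf_words_doubles_def rgf_words_def)
  then obtain w a where uw: "u = w @ [a]" by (cases u rule: rev_cases) auto
  have cnt: "count_list (w @ [a]) b \<le> 2" for b
    using u uw by (auto simp: rgf_words_doubles_def)
  have dbl: "doubles (w @ [a]) = L" and rgf: "w @ [a] \<in> rgf_words (Suc n) k"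
    using u uw by (auto simp: rgf_words_doubles_def)
  have cnt': "count_list w b \<le> 2" for b
    using cnt[of b] by simp
  from rgf_words_snocD[OF rgf] show "u \<in> ?B \<union> ?C"
  proof (elim disjE conjE)
    assume *: "a = k" "w \<in> rgf_words n (k - 1)"
    then have "k \<notin> set w" using \<open>0 < k\<close> by (auto simp: rgf_words_def)
    then have "doubles w = L" using dbl *(1) by (auto simp: doubles_def split: if_splits)
    then have "w \<in> rgf_words_doubles n (k - 1) L"
      using * cnt' by (simp add: rgf_words_doubles_def)
    then show ?thesis using uw *(1) by blast
  next
    assume *: "a \<in> {1..k}" "w \<in> rgf_words n k"
    \<comment> \<open>The prefix already uses the whole alphabet, so \<open>a\<close> has an earlier
      copy, and the bound 2 leaves room for exactly one.\<close>
    then have "a \<in> set w" by (simp add: rgf_words_def)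
    then have "count_list w a \<noteq> 0" by (simp add: count_list_0_iff)
    then have ca: "count_list w a = 1" using cnt[of a] by simp
    then have "a \<in> L" using dbl by (auto simp: doubles_def)
    have "doubles w = L - {a}"
      using dbl ca by (auto simp: doubles_def split: if_splits)
    then have "w \<in> rgf_words_doubles n k (L - {a})"
      using * cnt' by (simp add: rgf_words_doubles_def)
    then show ?thesis using uw \<open>a \<in> L\<close> by blast
  qed
next
  fix u assume "u \<in> ?B \<union> ?C"
  then show "u \<in> ?A"
  proof
    assume "u \<in> ?B"
    then obtain w where u: "u = w @ [k]" and w: "w \<in> rgf_words n (k - 1)"
      and cnt: "\<And>b. count_list w b \<le> 2" and dbl: "doubles w = L"
      by (auto simp: rgf_words_doubles_def)
    have set: "set w = {1..k - 1}" using w by (simp add: rgf_words_def)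
    have "k \<notin> set w" using set \<open>0 < k\<close> by auto
    then have "doubles u = L" "count_list u b \<le> 2" for b
      using dbl cnt[of b] u by (auto simp: doubles_def split: if_splits)
    moreover have "insert k {1..k - 1} = {1..k}" using \<open>0 < k\<close> by auto
    then have "u \<in> rgf_words (Suc n) k"
      unfolding u by (intro rgf_words_snocI[OF w]) (auto simp: set)
    ultimately show ?thesis by (simp add: rgf_words_doubles_def)
  next
    assume "u \<in> ?C"
    then obtain w l where u: "u = w @ [l]" and l: "l \<in> L" and w: "w \<in> rgf_words n k"
      and cnt: "\<And>b. count_list w b \<le> 2" and dbl: "doubles w = L - {l}"
      by (auto simp: rgf_words_doubles_def)
    have set: "set w = {1..k}" using w by (simp add: rgf_words_def)
    have "l \<in> {1..k}" using l assms by blast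
    have "count_list w l \<noteq> 0" using set \<open>l \<in> {1..k}\<close> by (simp add: count_list_0_iff)
    moreover have "count_list w l \<noteq> 2" using dbl by (auto simp: doubles_def)
    ultimately have cl: "count_list w l = 1" using cnt[of l] by linarith
    have "doubles u = insert l (doubles w)"
      using cl u by (auto simp: doubles_def split: if_splits)
    then have "doubles u = L" using dbl l by auto
    moreover have "count_list u b \<le> 2" for b using cl cnt[of b] u by auto
    moreover have "u \<in> rgf_words (Suc n) k"
      unfolding u using \<open>l \<in> {1..k}\<close> by (intro rgf_words_snocI[OF w]) (auto simp: set)
    ultimately show ?thesis by (simp add: rgf_words_doubles_def)
  qed
qed

lemma card_rgf_words_doubles_Suc:
  assumes "0 < k" "L \<subseteq> {1..k}"
  shows "card (rgf_words_doubles (Suc n) k L) =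
    card (rgf_words_doubles n (k - 1) L) + (\<Sum>l\<in>L. card (rgf_words_doubles n k (L - {l})))"
proof -
  have "finite L" using assms finite_subset by blast
  \<comment> \<open>The appended letter may be \<open>k\<close> in both parts of the union, so they
    are told apart by the alphabet of the remaining word; \<open>0 < k\<close> makes the two
    alphabets differ.\<close>
  have ne: "w \<notin> rgf_words n k" if "w \<in> rgf_words n (k - 1)" for w
  proof -
    have "k \<in> {1..k}" "k \<notin> {1..k - 1}" using \<open>0 < k\<close> by auto
    then have "{1..k - 1} \<noteq> {1..k}" by blast
    then show ?thesis using that unfolding rgf_words_def by blast
  qed
  have "card (rgf_words_doubles (Suc n) k L) =
    card ((\<lambda>w. w @ [k]) ` rgf_words_doubles n (k - 1) L) +
    card (\<Union>l\<in>L. (\<lambda>w. w @ [l]) ` rgf_words_doubles n k (L - {l}))"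
    unfolding rgf_words_doubles_Suc[OF assms]
  proof (rule card_Un_disjoint)
    show "(\<lambda>w. w @ [k]) ` rgf_words_doubles n (k - 1) L \<inter>
        (\<Union>l\<in>L. (\<lambda>w. w @ [l]) ` rgf_words_doubles n k (L - {l})) = {}"
      using ne unfolding rgf_words_doubles_def by blast
  qed (use \<open>finite L\<close> in \<open>simp_all add: finite_rgf_words_doubles\<close>)
  also have "card (\<Union>l\<in>L. (\<lambda>w. w @ [l]) ` rgf_words_doubles n k (L - {l})) =
    (\<Sum>l\<in>L. card ((\<lambda>w. w @ [l]) ` rgf_words_doubles n k (L - {l})))"
    using \<open>finite L\<close> finite_rgf_words_doubles by (intro card_UN_disjoint) auto
  also have "\<dots> = (\<Sum>l\<in>L. card (rgf_words_doubles n k (L - {l})))"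
    by (intro sum.cong refl card_image) (simp add: inj_on_def)
  also have "card ((\<lambda>w. w @ [k]) ` rgf_words_doubles n (k - 1) L) =
    card (rgf_words_doubles n (k - 1) L)"
    by (intro card_image) (simp add: inj_on_def)
  finally show ?thesis .
qed

section \<open>The product formula and its recursion\<close>

text \<open>Insert the second copies of the letters of \<open>L\<close> into \<open>1 2 \<dots> k\<close>, largest letter first: the
  factor of \<open>l\<close> is the number of places to the right of the first \<open>l\<close>. The argument \<open>k\<close> is an
  integer so that \<open>placements_rec\<close> holds unconditionally; when \<open>k \<in> L\<close> its term for \<open>k - 1\<close> vanishes,
  just as no word on \<open>k - 1\<close> letters has \<open>k\<close> doubled.\<close>

definition placements :: "int \<Rightarrow> nat set \<Rightarrow> int" where
  "placements k L = (\<Prod>l\<in>L. k - int l + int (card {x \<in> L. l \<le> x}))"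

lemma placements_empty [simp]: "placements k {} = 1"
  by (simp add: placements_def)

text \<open>Each factor counts only elements at or above its own, so a new minimum leaves the old
  factors alone, while its own factor counts all of \<open>A\<close> and itself.\<close>

lemma placements_insert_min:
  assumes "finite A" "\<forall>a\<in>A. b < a"
  shows "placements k (insert b A) = (k - int b + int (card A) + 1) * placements k A"
proof -
  have "b \<notin> A" using assms by auto
  moreover have "{x \<in> insert b A. b \<le> x} = insert b A" using assms by auto
  moreover have "{x \<in> insert b A. l \<le> x} = {x \<in> A. l \<le> x}" if "l \<in> A" for l
    using assms that by auto
  ultimately show ?thesis using assms by (simp add: placements_def algebra_simps)
qed

text \<open>Let \<open>b\<close> be the minimum and \<open>c = k - b + card A\<close>. Deleting
  \<open>b\<close> gives \<open>placements k A\<close>; deleting another \<open>l\<close> lowers the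
  factor of \<open>b\<close> from \<open>c + 1\<close> to \<open>c\<close>. The induction hypothesis
  turns the remaining sum into \<open>placements k A - placements (k - 1) A\<close>, and its second
  term, multiplied by \<open>c\<close>, cancels
  \<open>placements (k - 1) (insert b A)\<close>.\<close>

lemma placements_rec:
  assumes "finite L"
  shows "placements k L = placements (k - 1) L + (\<Sum>l\<in>L. placements k (L - {l}))"
  using assms
proof (induction L rule: finite_linorder_min_induct)
  case empty
  then show ?case by simp
next
  case (insert b A)
  have "b \<notin> A" using insert by auto
  have "placements k (insert b A - {l}) = (k - int b + int (card A)) * placements k (A - {l})"
    if "l \<in> A" for l
  proof -
    have "insert b A - {l} = insert b (A - {l})" using that \<open>b \<notin> A\<close> by auto
    moreover have "int (card A) = int (card (A - {l})) + 1"
      using card_Suc_Diff1[OF insert(1) that] by linarith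
    ultimately show ?thesis
      using placements_insert_min[of "A - {l}" b k] insert by simp
  qed
  then have "(\<Sum>l\<in>insert b A. placements k (insert b A - {l})) =
    placements k A + (k - int b + int (card A)) * (\<Sum>l\<in>A. placements k (A - {l}))"
    using insert \<open>b \<notin> A\<close> by (simp add: sum_distrib_left)
  also have "(\<Sum>l\<in>A. placements k (A - {l})) = placements k A - placements (k - 1) A"
    using insert.IH by simp
  finally show ?case
    using insert by (simp add: placements_insert_min algebra_simps)
qed

text \<open>Only \<open>k\<close> itself lies at or above \<open>k\<close>, so its factor is
  \<open>k - 1 - k + 1\<close>.\<close>

lemma placements_eq_0:
  assumes "k \<in> L" "L \<subseteq> {..k}"
  shows "placements (int k - 1) L = 0"
proof -
  have "{x \<in> L. k \<le> x} = {k}" using assms by auto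
  then have "int k - 1 - int k + int (card {x \<in> L. k \<le> x}) = 0" by simp
  then show ?thesis unfolding placements_def
    using assms finite_subset[OF assms(2)] by (intro prod_zero bexI[of _ k]) auto
qed

text \<open>Induction on the length: replacing \<open>k\<close> by \<open>k - 1\<close>, or removing
  one element of \<open>L\<close>, lowers \<open>k + card L\<close> by one, so the hypothesis on
  \<open>n\<close> survives in both branches of the recursion.\<close>

lemma card_rgf_words_doubles:
  assumes "L \<subseteq> {1..k}" "n = k + card L"
  shows "int (card (rgf_words_doubles n k L)) = placements (int k) L"
  using assms
proof (induction n arbitrary: k L)
  case 0
  then have "k = 0" "L = {}" by auto
  moreover have "rgf_words_doubles 0 0 {} = {[]}"
    by (auto simp: rgf_words_doubles_def rgf_words_def doubles_def)
  ultimately show ?case by simp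
next
  case (Suc n)
  have "finite L" using Suc finite_subset by blast
  have "0 < k" using Suc by (cases k) auto
  have "int (card (rgf_words_doubles n (k - 1) L)) = placements (int k - 1) L"
  proof (cases "k \<in> L")
    case True
    then have "\<not> L \<subseteq> {1..k - 1}" using \<open>0 < k\<close> by auto
    moreover have "placements (int k - 1) L = 0"
      using True Suc.prems by (intro placements_eq_0) auto
    ultimately show ?thesis by (simp add: rgf_words_doubles_empty)
  next
    case False
    have "L \<subseteq> {1..k - 1}"
    proof
      fix l assume "l \<in> L"
      then have "l \<in> {1..k}" "l \<noteq> k" using Suc.prems False by auto
      then show "l \<in> {1..k - 1}" by auto
    qed
    moreover have "n = k - 1 + card L" using Suc.prems \<open>0 < k\<close> by simp
    ultimately show ?thesis using Suc.IH[of L "k - 1"] \<open>0 < k\<close> by (simp add: of_nat_diff)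
  qed
  moreover have "int (card (rgf_words_doubles n k (L - {l}))) = placements (int k) (L - {l})"
    if "l \<in> L" for l
  proof (rule Suc.IH)
    show "n = k + card (L - {l})"
      using Suc.prems card_Suc_Diff1[OF \<open>finite L\<close> that] by simp
  qed (use Suc.prems in blast)
  ultimately show ?case
    using placements_rec[OF \<open>finite L\<close>, of "int k"]
    by (simp add: card_rgf_words_doubles_Suc[OF \<open>0 < k\<close> Suc.prems(1)])
qed

section \<open>The product indexed by the elements of \<open>L\<close> in decreasing order\<close>

lemma bij_betw_nth_largest:
  assumes "finite L"
  shows "bij_betw (nth_largest L) {1..card L} L"
proof -
  have "bij_betw (\<lambda>g. g - 1) {1..card L} {..<card L}"
    by (rule bij_betw_byWitness[where f' = Suc]) auto
  moreover have "bij_betw ((!) (rev (sorted_list_of_set L))) {..<card L} L"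
    using assms by (intro bij_betw_nth) auto
  ultimately show ?thesis
    using bij_betw_trans unfolding nth_largest_def comp_def by fastforce
qed

text \<open>\<open>nth_largest L\<close> is strictly decreasing, so the elements at or above its
  value at \<open>g\<close> are those with indices \<open>1..g\<close>. This turns the count in
  \<open>placements\<close> into the summand \<open>g\<close> of the theorem.\<close>

lemma card_ge_nth_largest:
  assumes "finite L" "g \<in> {1..card L}"
  shows "card {x \<in> L. nth_largest L g \<le> x} = g"
proof -
  let ?f = "nth_largest L"
  have anti: "?f h < ?f i" if "i < h" "i \<in> {1..card L}" "h \<in> {1..card L}" for h i
    using that assms strict_sorted_list_of_set[of L]
    by (auto simp: nth_largest_def rev_nth intro!: sorted_wrt_nth_less[where P = "(<)"])
  have "{x \<in> L. ?f g \<le> x} = ?f ` {1..g}"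
  proof (intro equalityI subsetI)
    fix x assume x: "x \<in> {x \<in> L. ?f g \<le> x}"
    then obtain h where "h \<in> {1..card L}" "x = ?f h"
      using bij_betw_nth_largest[OF assms(1)] unfolding bij_betw_def by blast
    then show "x \<in> ?f ` {1..g}" using anti[of g h] x assms(2) by (cases "h \<le> g") auto
  next
    fix x assume "x \<in> ?f ` {1..g}"
    then obtain h where h: "h \<in> {1..g}" "x = ?f h" by blast
    then have "h \<in> {1..card L}" using assms by auto
    then show "x \<in> {x \<in> L. ?f g \<le> x}"
      using anti[of h g] h assms bij_betwE[OF bij_betw_nth_largest[OF assms(1)]]
      by (cases "h = g") auto
  qed
  moreover have "inj_on ?f {1..g}"
    using bij_betw_nth_largest[OF assms(1)] assms(2)
    by (auto simp: bij_betw_def intro: inj_on_subset)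
  ultimately show ?thesis by (simp add: card_image)
qed

lemma placements_nth_largest:
  assumes "finite L"
  shows "placements k L = (\<Prod>g=1..card L. k - int (nth_largest L g) + int g)"
proof -
  have "placements k L = (\<Prod>g=1..card L. k - int (nth_largest L g) +
      int (card {x \<in> L. nth_largest L g \<le> x}))"
    unfolding placements_def
    using prod.reindex_bij_betw[OF bij_betw_nth_largest[OF assms],
        of "\<lambda>l. k - int l + int (card {x \<in> L. l \<le> x})"] by simp
  then show ?thesis using card_ge_nth_largest[OF assms] by simp
qed

section \<open>The statistic on words\<close>

lemma ls_word_rgf_words:
  assumes "w \<in> rgf_words n k"
  shows "ls_word w = (\<Sum>a=1..k. count_list w a * (a - 1))"
proof -
  have len: "length w = n" and set: "set w = {1..k}"
    and rg: "\<And>i. i < n \<Longrightarrow> {1..<w ! i} \<subseteq> set (take i w)"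
    using assms by (auto simp: rgf_words_def)
  \<comment> \<open>Restricted growth puts every smaller letter to the left of position
    \<open>j\<close>, so that position contributes exactly \<open>w ! j - 1\<close>.\<close>
  have "{w ! i |i. i < j \<and> w ! i < w ! j} = {1..<w ! j}" if "j < n" for j
  proof (intro equalityI subsetI)
    fix a assume "a \<in> {w ! i |i. i < j \<and> w ! i < w ! j}"
    then show "a \<in> {1..<w ! j}"
      using set len that nth_mem[of _ w] by (fastforce simp: Suc_le_eq)
  next
    fix a assume a: "a \<in> {1..<w ! j}"
    then have "a \<in> set (take j w)" using rg[OF that] by blast
    then obtain i where "i < j" "w ! i = a" by (auto simp: in_set_conv_nth)
    then show "a \<in> {w ! i |i. i < j \<and> w ! i < w ! j}" using a by auto
  qed
  then have "ls_word w = (\<Sum>j<length w. w ! j - 1)"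
    by (simp add: ls_word_def len)
  also have "\<dots> = sum_list (map (\<lambda>a. a - 1) w)"
    by (simp add: sum_list_sum_nth atLeast0LessThan)
  also have "\<dots> = (\<Sum>a=1..k. count_list w a * (a - 1))"
    by (simp add: sum_list_map_eq_sum_count set)
  finally show ?thesis .
qed

text \<open>Each letter contributes once, and those of \<open>L\<close> once more. The weight is
  arbitrary because \<open>a - 1\<close> yields the statistic and the constant 1 yields the
  length.\<close>

lemma sum_count_rgf_words_doubles:
  assumes "w \<in> rgf_words_doubles n k L"
  shows "(\<Sum>a=1..k. count_list w a * f a) = (\<Sum>a=1..k. f a) + (\<Sum>a\<in>L. f a)"
proof -
  have set: "set w = {1..k}" and cnt: "\<And>a. count_list w a \<le> 2" and dbl: "doubles w = L"
    using assms by (auto simp: rgf_words_doubles_def rgf_words_def)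
  have "L \<subseteq> {1..k}" using doubles_subset[of w] set dbl by simp
  have "count_list w a = 1 + of_bool (a \<in> L)" if "a \<in> {1..k}" for a
  proof -
    have "count_list w a \<noteq> 0" using that set by (simp add: count_list_0_iff)
    then show ?thesis using cnt[of a] dbl by (auto simp: doubles_def)
  qed
  then have "(\<Sum>a=1..k. count_list w a * f a) = (\<Sum>a=1..k. f a + (if a \<in> L then f a else 0))"
    by (intro sum.cong) auto
  also have "\<dots> = (\<Sum>a=1..k. f a) + (\<Sum>a\<in>{1..k} \<inter> L. f a)"
    by (simp only: sum.distrib) (simp add: sum.inter_restrict)
  also have "{1..k} \<inter> L = L" using \<open>L \<subseteq> {1..k}\<close> by auto
  finally show ?thesis .
qed

lemma sum_pred_eq_choose_two: "(\<Sum>a=1..k. a - 1) = k choose 2"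
  by (induction k) (auto simp: numeral_2_eq_2)

lemma ls_word_rgf_words_doubles:
  assumes "w \<in> rgf_words_doubles n k L"
  shows "ls_word w = (k choose 2) + (\<Sum>l\<in>L. l - 1)"
  using assms ls_word_rgf_words[of w n k] sum_count_rgf_words_doubles[OF assms, of "\<lambda>a. a - 1"]
  unfolding sum_pred_eq_choose_two by (simp add: rgf_words_doubles_def)

lemma card_doubles:
  assumes "w \<in> rgf_words_doubles n k L"
  shows "n = k + card L"
proof -
  have "length w = n" "set w = {1..k}"
    using assms by (auto simp: rgf_words_doubles_def rgf_words_def)
  then show ?thesis
    using sum_count_set[of w "{1..k}"] sum_count_rgf_words_doubles[OF assms, of "\<lambda>_. 1"] by simp
qed

section \<open>Set partitions and restricted growth words\<close>

lemma finite_partition_block: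
  assumes "partition_on {1..n} P" "B \<in> P"
  shows "finite (B :: nat set)" "B \<noteq> {}" "B \<subseteq> {1..n}"
proof -
  show "B \<subseteq> {1..n}" using assms by (auto simp: partition_on_def)
  then show "finite B" using finite_subset by blast
  show "B \<noteq> {}" using assms by (auto simp: partition_on_def)
qed

text \<open>A common minimum would lie in two disjoint blocks. Hence sorting by \<open>Min\<close>
  has no ties.\<close>

lemma inj_on_Min_partition:
  assumes "partition_on {1..n::nat} P"
  shows "inj_on Min P"
proof (rule inj_onI)
  fix B C assume "B \<in> P" "C \<in> P" "Min B = Min C"
  then have "Min B \<in> B \<inter> C"
    using finite_partition_block[OF assms] by (metis IntI Min_in)
  then show "B = C"
    using assms \<open>B \<in> P\<close> \<open>C \<in> P\<close> by (auto simp: partition_on_def disjoint_def)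
qed

text \<open>Stated inside the class because a global interpretation of the locale
  \<open>folding_insort_key\<close> speaks about the foundational constant
  \<open>linorder.sorted_key_list_of_set (\<le>)\<close> rather than about the class constant.\<close>

lemma (in linorder) sorted_key_list_of_set_inj_on:
  assumes "inj_on f A" "finite A"
  shows "sorted_wrt (<) (map f (sorted_key_list_of_set f A))"
    and "set (sorted_key_list_of_set f A) = A"
    and "length (sorted_key_list_of_set f A) = card A"
    and "sorted_wrt (<) (map f xs) \<Longrightarrow> set xs = A \<Longrightarrow> length xs = card A \<Longrightarrow>
      sorted_key_list_of_set f A = xs"
proof -
  interpret folding_insort_key "(\<le>)" "(<)" A f
    by unfold_locales (rule assms)
  show "sorted_wrt (<) (map f (sorted_key_list_of_set f A))"
    "set (sorted_key_list_of_set f A) = A" "length (sorted_key_list_of_set f A) = card A"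
    using assms by simp_all
  show "sorted_wrt (<) (map f xs) \<Longrightarrow> set xs = A \<Longrightarrow> length xs = card A \<Longrightarrow>
      sorted_key_list_of_set f A = xs"
    using sorted_key_list_of_set_unique[of A] assms(2) by blast
qed

lemma finite_partition:
  assumes "partition_on {1..n::nat} P"
  shows "finite P"
  using finite_elements[OF _ assms] by simp

lemma bij_betw_nth_block:
  assumes "partition_on {1..n} P"
  shows "bij_betw (nth_block P) {1..card P} P"
proof -
  note xs = sorted_key_list_of_set_inj_on[OF inj_on_Min_partition[OF assms] finite_partition[OF assms]]
  let ?xs = "sorted_key_list_of_set Min P"
  have "bij_betw (\<lambda>g. g - 1) {1..card P} {..<card P}"
    by (rule bij_betw_byWitness[where f' = Suc]) auto
  moreover have "distinct ?xs"
    using xs(2,3) card_distinct by metis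
  then have "bij_betw ((!) ?xs) {..<card P} P"
    using xs(2,3) by (intro bij_betw_nth) auto
  ultimately show ?thesis
    using bij_betw_trans unfolding nth_block_def comp_def by fastforce
qed

lemma Min_nth_block_less:
  assumes "partition_on {1..n} P" "1 \<le> i" "i < j" "j \<le> card P"
  shows "Min (nth_block P i) < Min (nth_block P j)"
proof -
  note xs = sorted_key_list_of_set_inj_on[OF inj_on_Min_partition[OF assms(1)]
      finite_partition[OF assms(1)]]
  let ?xs = "sorted_key_list_of_set Min P"
  have "sorted_wrt (<) (map Min ?xs)" "length ?xs = card P"
    using xs(1,3) by auto
  then show ?thesis
    using assms sorted_wrt_nth_less[of "(<)" "map Min ?xs" "i - 1" "j - 1"]
    by (simp add: nth_block_def)
qed

text \<open>Strictly increasing minima make the list of values of \<open>f\<close> distinct, and the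
  strictly sorted enumeration of \<open>P\<close> is unique. This identifies the blocks read off a
  word.\<close>

lemma nth_block_eqI:
  assumes P: "partition_on {1..n} P"
    and f: "f ` {1..k} = P" "\<And>i j. 1 \<le> i \<Longrightarrow> i < j \<Longrightarrow> j \<le> k \<Longrightarrow> Min (f i) < Min (f j)"
    and j: "j \<in> {1..k}"
  shows "nth_block P j = f j"
proof -
  note xs = sorted_key_list_of_set_inj_on[OF inj_on_Min_partition[OF P] finite_partition[OF P]]
  let ?l = "map f [1..<Suc k]"
  have sorted: "sorted_wrt (<) (map Min ?l)"
    using f(2) by (auto simp: sorted_wrt_iff_nth_less simp del: upt_Suc)
  then have "distinct (map Min ?l)" by (simp only: strict_sorted_iff)
  then have "distinct ?l" using distinct_map by blast
  moreover have set: "set ?l = P" using f(1) by (auto simp: atLeastLessThanSuc_atLeastAtMost simp del: upt_Suc)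
  ultimately have "length ?l = card P" using distinct_card by metis
  then have "sorted_key_list_of_set Min P = ?l"
    using sorted set xs(4) by blast
  then show ?thesis using j by (auto simp: nth_block_def simp del: upt_Suc)
qed

section \<open>The restricted growth function and its inverse\<close>

lemma length_rgf [simp]: "length (rgf n P) = n"
  by (simp add: rgf_def)

lemma rgf_nth_eqI:
  assumes "partition_on {1..n} P" "i < n" "j \<in> {1..card P}" "Suc i \<in> nth_block P j"
  shows "rgf n P ! i = j"
proof -
  \<comment> \<open>Uniqueness for the definite description: blocks sharing an element coincide, and
    \<open>nth_block P\<close> is injective on indices. List position \<open>i\<close> stands for
    the element \<open>Suc i\<close>.\<close>
  have "j' = j" if "j' \<in> {1..card P}" "Suc i \<in> nth_block P j'" for j'
  proof -
    have "nth_block P j \<in> P" "nth_block P j' \<in> P"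
      using bij_betwE[OF bij_betw_nth_block[OF assms(1)]] assms(3) that(1) by auto
    then have "nth_block P j' = nth_block P j"
      using assms that by (auto simp: partition_on_def disjoint_def)
    then show ?thesis
      using bij_betw_nth_block[OF assms(1)] assms(3) that(1)
      by (auto simp: bij_betw_def dest: inj_onD)
  qed
  then have "(THE j. j \<in> {1..card P} \<and> Suc i \<in> nth_block P j) = j"
    using assms(3,4) by (blast intro: the_equality)
  then show ?thesis using assms by (simp add: rgf_def del: upt_Suc)
qed

lemma rgf_nth:
  assumes "partition_on {1..n} P" "i < n"
  shows "rgf n P ! i \<in> {1..card P}" "Suc i \<in> nth_block P (rgf n P ! i)"
proof -
  have "Suc i \<in> \<Union>P" using assms by (auto simp: partition_on_def)
  then obtain j where "j \<in> {1..card P}" "Suc i \<in> nth_block P j"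
    using bij_betw_nth_block[OF assms(1)] unfolding bij_betw_def by blast
  with rgf_nth_eqI[OF assms this]
  show "rgf n P ! i \<in> {1..card P}" "Suc i \<in> nth_block P (rgf n P ! i)" by auto
qed

text \<open>These sets are the blocks of the partition encoded by \<open>w\<close>;
  \<open>Suc\<close> shifts positions counted from 0 to elements counted from 1.\<close>

definition word_block :: "nat list \<Rightarrow> nat \<Rightarrow> nat set" where
  "word_block w j = Suc ` {i. i < length w \<and> w ! i = j}"

lemma card_word_block: "card (word_block w j) = count_list w j"
  by (simp add: word_block_def card_image count_list_eq_length_filter length_filter_conv_card
      eq_commute)

lemma word_block_rgf:
  assumes "partition_on {1..n} P" "j \<in> {1..card P}"
  shows "word_block (rgf n P) j = nth_block P j"
proof (intro equalityI subsetI)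
  fix x assume "x \<in> word_block (rgf n P) j"
  then show "x \<in> nth_block P j" using rgf_nth[OF assms(1)] by (auto simp: word_block_def)
next
  fix x assume x: "x \<in> nth_block P j"
  have "nth_block P j \<in> P"
    using bij_betwE[OF bij_betw_nth_block[OF assms(1)]] assms(2) by auto
  then have "x \<in> {1..n}" using x finite_partition_block[OF assms(1)] by blast
  then obtain i where i: "x = Suc i" "i < n" by (cases x) auto
  then have "rgf n P ! i = j" using rgf_nth_eqI assms x by blast
  then show "x \<in> word_block (rgf n P) j" using i by (auto simp: word_block_def)
qed

lemma word_blocks_rgf:
  assumes "partition_on {1..n} P"
  shows "word_block (rgf n P) ` {1..card P} = P"
  using bij_betw_nth_block[OF assms] word_block_rgf[OF assms] by (simp add: bij_betw_def)

text \<open>The minimum of block \<open>j\<close> is a position with letter \<open>j\<close>. If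
  \<open>j\<close> is below the letter at \<open>i\<close>, this minimum precedes that of the block
  of \<open>Suc i\<close>, hence lies to the left of position \<open>i\<close>.\<close>

lemma rgf_in_rgf_words:
  assumes "partition_on {1..n} P"
  shows "rgf n P \<in> rgf_words n (card P)"
proof -
  have occ: "Min (nth_block P j) \<in> nth_block P j" if "j \<in> {1..card P}" for j
    using that bij_betwE[OF bij_betw_nth_block[OF assms]] finite_partition_block[OF assms]
    by (metis Min_in)
  have pos: "\<exists>h<n. Suc h = Min (nth_block P j) \<and> rgf n P ! h = j" if "j \<in> {1..card P}" for j
    using occ[OF that] unfolding word_block_rgf[OF assms that, symmetric]
    by (auto simp: word_block_def)
  have "set (rgf n P) = {1..card P}"
  proof (intro equalityI subsetI)
    fix j assume "j \<in> set (rgf n P)"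
    then show "j \<in> {1..card P}" using rgf_nth(1)[OF assms] by (auto simp: in_set_conv_nth)
  next
    fix j assume "j \<in> {1..card P}"
    then show "j \<in> set (rgf n P)" using pos by (metis length_rgf nth_mem)
  qed
  moreover have "j \<in> set (take i (rgf n P))" if "i < n" "j \<in> {1..<rgf n P ! i}" for i j
  proof -
    have r: "rgf n P ! i \<in> {1..card P}" using rgf_nth(1)[OF assms \<open>i < n\<close>] .
    then have "j \<in> {1..card P}" using that by auto
    then obtain h where h: "h < n" "Suc h = Min (nth_block P j)" "rgf n P ! h = j"
      using pos by blast
    have "Min (nth_block P j) < Min (nth_block P (rgf n P ! i))"
      using that r by (intro Min_nth_block_less[OF assms]) auto
    also have "\<dots> \<le> Suc i"
      using r rgf_nth(2)[OF assms \<open>i < n\<close>] bij_betwE[OF bij_betw_nth_block[OF assms]]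
        finite_partition_block[OF assms] by (intro Min_le) auto
    finally have "h < i" using h by simp
    then show ?thesis using h that by (auto simp: in_set_conv_nth)
  qed
  ultimately show ?thesis by (auto simp: rgf_words_def)
qed

text \<open>By restricted growth the first occurrence of \<open>j\<close> comes after an occurrence
  of every smaller letter. The sets \<open>word_block w j\<close> are thus already ordered by their
  minima, and \<open>nth_block\<close> returns them with the same indices.\<close>

lemma rgf_word_blocks:
  assumes "w \<in> rgf_words n k"
  defines "P \<equiv> word_block w ` {1..k}"
  shows "partition_on {1..n} P" "card P = k" "rgf n P = w"
proof -
  have len: "length w = n" and set: "set w = {1..k}"
    and rg: "\<And>i. i < n \<Longrightarrow> {1..<w ! i} \<subseteq> set (take i w)"
    using assms by (auto simp: rgf_words_def)
  have ne: "word_block w j \<noteq> {}" if "j \<in> {1..k}" for j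
    using that unfolding set[symmetric] by (auto simp: word_block_def in_set_conv_nth)
  show P: "partition_on {1..n} P"
  proof (rule partition_onI)
    show "\<Union>P = {1..n}"
    proof (intro equalityI subsetI)
      fix x assume "x \<in> {1..n}"
      then obtain i where i: "x = Suc i" "i < n" by (cases x) auto
      then have "w ! i \<in> {1..k}" using len set nth_mem by blast
      moreover have "x \<in> word_block w (w ! i)" using i len by (auto simp: word_block_def)
      ultimately show "x \<in> \<Union>P" by (auto simp: P_def)
    qed (auto simp: P_def word_block_def len)
  next
    fix B C assume "B \<in> P" "C \<in> P" "B \<noteq> C"
    then show "disjnt B C" by (auto simp: P_def word_block_def disjnt_def)
  next
    show "{} \<notin> P" using ne unfolding P_def by (metis imageE)
  qed
  have fin: "finite (word_block w j)" for j by (simp add: word_block_def)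
  have "Min (word_block w i) < Min (word_block w j)" if ij: "1 \<le> i" "i < j" "j \<le> k" for i j
  proof -
    have "Min (word_block w j) \<in> word_block w j" using fin ne ij by (intro Min_in) auto
    then obtain h where h: "h < n" "w ! h = j" "Min (word_block w j) = Suc h"
      by (auto simp: word_block_def len)
    then have "i \<in> set (take h w)" using rg[of h] ij by auto
    then obtain g where g: "g < h" "w ! g = i" by (auto simp: in_set_conv_nth)
    then have "Suc g \<in> word_block w i" using h len by (auto simp: word_block_def)
    then have "Min (word_block w i) \<le> Suc g" using fin by simp
    then show ?thesis using g h by simp
  qed
  then have nth: "nth_block P j = word_block w j" if "j \<in> {1..k}" for j
    using nth_block_eqI[OF P, of "word_block w" k j] that P_def by simp
  have "inj_on (word_block w) {1..k}"
  proof (rule inj_onI)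
    fix i j assume ij: "i \<in> {1..k}" "word_block w i = word_block w j"
    then obtain x where "x \<in> word_block w i" "x \<in> word_block w j" using ne by blast
    then show "i = j" by (auto simp: word_block_def)
  qed
  then show card: "card P = k" by (simp add: P_def card_image)
  show "rgf n P = w"
  proof (rule nth_equalityI)
    fix i assume "i < length (rgf n P)"
    then have i: "i < n" by simp
    then have wi: "w ! i \<in> {1..k}" using len set nth_mem by blast
    then show "rgf n P ! i = w ! i"
      using i nth[OF wi] len card by (intro rgf_nth_eqI[OF P]) (auto simp: word_block_def)
  qed (simp add: len)
qed

lemma bij_betw_rgf:
  "bij_betw (rgf n) {P. partition_on {1..n} P \<and> card P = k} (rgf_words n k)"
proof (rule bij_betw_byWitness[where f' = "\<lambda>w. word_block w ` {1..k}"])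
  show "\<forall>P\<in>{P. partition_on {1..n} P \<and> card P = k}. word_block (rgf n P) ` {1..k} = P"
    using word_blocks_rgf by blast
  show "rgf n ` {P. partition_on {1..n} P \<and> card P = k} \<subseteq> rgf_words n k"
    using rgf_in_rgf_words by blast
qed (use rgf_word_blocks in blast)+

section \<open>Avoiding 123 as a bound on block sizes\<close>

lemma std_image:
  assumes "finite S"
  shows "std S ` S = {1..card S}"
proof -
  \<comment> \<open>Strict monotonicity gives injectivity; the image then has \<open>card S\<close>
    elements inside \<open>{1..card S}\<close> and must fill it.\<close>
  have "std S a < std S b" if "a \<in> S" "b \<in> S" "a < b" for a b
  proof -
    have "{y \<in> S. y \<le> a} \<subseteq> {y \<in> S. y \<le> b}" "b \<in> {y \<in> S. y \<le> b}" "b \<notin> {y \<in> S. y \<le> a}"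
      using that by auto
    then have "{y \<in> S. y \<le> a} \<subset> {y \<in> S. y \<le> b}" by blast
    then show ?thesis unfolding std_def using assms by (intro psubset_card_mono) auto
  qed
  then have "inj_on (std S) S"
    by (metis (no_types, lifting) inj_onI less_irrefl linorder_neqE_nat)
  then have "card (std S ` S) = card {1..card S}" by (simp add: card_image)
  moreover have "std S a \<in> {1..card S}" if "a \<in> S" for a
  proof -
    have "{y \<in> S. y \<le> a} \<noteq> {}" using that by auto
    then show ?thesis
      using assms by (auto simp: std_def Suc_le_eq card_gt_0_iff intro: card_mono)
  qed
  ultimately show ?thesis by (intro card_subset_eq) auto
qed

text \<open>Restriction and standardization never enlarge a block, so a block of size
  \<open>m\<close> must come from one at least as large. Conversely, an \<open>m\<close>-subset of a
  single block meets no other block and standardizes to \<open>{1..m}\<close>.\<close>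

lemma contains_one_block_iff:
  assumes "partition_on {1..n} P" "0 < m"
  shows "contains P {{1..m}} \<longleftrightarrow> (\<exists>B\<in>P. m \<le> card B)"
proof
  assume "contains P {{1..m}}"
  then obtain S where "restrict_std P S = {{1..m}}" by (auto simp: contains_def)
  then have "{1..m} \<in> restrict_std P S" by simp
  then obtain B where B: "B \<in> P" "std S ` (B \<inter> S) = {1..m}"
    by (auto simp: restrict_std_def)
  have "finite B" using finite_partition_block[OF assms(1) B(1)] by simp
  have "m = card (std S ` (B \<inter> S))" using B by simp
  also have "\<dots> \<le> card (B \<inter> S)" using \<open>finite B\<close> by (intro card_image_le) auto
  also have "\<dots> \<le> card B" using \<open>finite B\<close> by (intro card_mono) auto
  finally show "\<exists>B\<in>P. m \<le> card B" using B by blast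
next
  assume "\<exists>B\<in>P. m \<le> card B"
  then obtain B where B: "B \<in> P" "m \<le> card B" by blast
  then obtain S where S: "S \<subseteq> B" "card S = m" "finite S"
    using obtain_subset_with_card_n by metis
  \<comment> \<open>Positivity of \<open>m\<close> ensures that \<open>S\<close> survives the
    removal of empty intersections.\<close>
  have "S \<noteq> {}" using S assms(2) by auto
  have "C \<inter> S = {}" if "C \<in> P" "C \<noteq> B" for C
  proof -
    have "C \<inter> B = {}"
      using that B(1) partition_onD2[OF assms(1)] by (auto simp: disjoint_def)
    then show ?thesis using S(1) by blast
  qed
  then have "(\<lambda>C. C \<inter> S) ` P - {{}} = {S}" using B S \<open>S \<noteq> {}\<close> by auto
  then have "restrict_std P S = {{1..m}}" using S by (simp add: restrict_std_def std_image)
  then show "contains P {{1..m}}" using S(1) B(1) unfolding contains_def by blast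
qed

text \<open>Block sizes of \<open>P\<close> are letter multiplicities of \<open>rgf n P\<close>, so
  the bound on blocks becomes a bound on counts.\<close>

lemma bij_betw_rgf_avoiding:
  "bij_betw (rgf n) (avoiding n k {{1, 2, 3}}) {w \<in> rgf_words n k. \<forall>a. count_list w a \<le> 2}"
proof -
  have iff: "\<not> contains P {{1, 2, 3}} \<longleftrightarrow> (\<forall>a. count_list (rgf n P) a \<le> 2)"
    if P: "partition_on {1..n} P" for P
  proof -
    have "{1, 2, 3} = {1..3::nat}" by auto
    then have "\<not> contains P {{1, 2, 3}} \<longleftrightarrow> (\<forall>B\<in>P. card B \<le> 2)"
      using contains_one_block_iff[OF P, of 3] by (auto simp: not_le less_Suc_eq_le numeral_3_eq_3 numeral_2_eq_2)
    also have "\<dots> \<longleftrightarrow> (\<forall>B\<in>word_block (rgf n P) ` {1..card P}. card B \<le> 2)"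
      by (simp only: word_blocks_rgf[OF P])
    also have "\<dots> \<longleftrightarrow> (\<forall>a\<in>set (rgf n P). count_list (rgf n P) a \<le> 2)"
      using rgf_in_rgf_words[OF P] by (simp add: card_word_block rgf_words_def)
    also have "\<dots> \<longleftrightarrow> (\<forall>a. count_list (rgf n P) a \<le> 2)"
      by (metis count_notin zero_le)
    finally show ?thesis .
  qed
  have "avoiding n k {{1, 2, 3}} =
    {P \<in> {P. partition_on {1..n} P \<and> card P = k}. \<forall>a. count_list (rgf n P) a \<le> 2}"
    using iff by (auto simp: avoiding_def)
  moreover have "rgf n ` {P \<in> {P. partition_on {1..n} P \<and> card P = k}.
      \<forall>a. count_list (rgf n P) a \<le> 2} = {w \<in> rgf_words n k. \<forall>a. count_list w a \<le> 2}"
    unfolding bij_betw_imp_surj_on[OF bij_betw_rgf, symmetric] by blast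
  ultimately show ?thesis
    using bij_betw_rgf[of n k] by (auto simp: bij_betw_def intro: inj_on_subset)
qed

theorem theorem6p1:
  fixes n k :: nat
  assumes "1 \<le> k" and "k \<le> n"
  shows "LS n k {{1, 2, 3}} =
    (\<Sum>L | L \<subseteq> {1..k} \<and> card L = n - k.
       smult (\<Prod>g=1..n - k. int k - int (nth_largest L g) + int g)
         (monom 1 ((k choose 2) + (\<Sum>l\<in>L. l - 1))))"
proof -
  let ?W = "{w \<in> rgf_words n k. \<forall>a. count_list w a \<le> 2}"
  let ?T = "{L. L \<subseteq> {1..k} \<and> card L = n - k}"
  have W: "{w \<in> ?W. doubles w = L} = rgf_words_doubles n k L" for L
    by (auto simp: rgf_words_doubles_def)
  \<comment> \<open>The word has length \<open>n\<close> and \<open>k\<close> distinct letters, each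
    used at most twice, which forces exactly \<open>n - k\<close> doubled letters.\<close>
  have dbl: "doubles ` ?W \<subseteq> ?T"
  proof
    fix L assume "L \<in> doubles ` ?W"
    then obtain w where w: "w \<in> rgf_words_doubles n k L" using W by blast
    then have "L \<subseteq> {1..k}" using rgf_words_doubles_empty by blast
    then show "L \<in> ?T" using card_doubles[OF w] by simp
  qed
  have "LS n k {{1, 2, 3}} = (\<Sum>w\<in>?W. monom 1 (ls_word w))"
    unfolding LS_def by (rule sum.reindex_bij_betw[OF bij_betw_rgf_avoiding])
  also have "\<dots> = (\<Sum>L\<in>?T. \<Sum>w | w \<in> ?W \<and> doubles w = L. monom 1 (ls_word w))"
    using dbl finite_rgf_words by (intro sum.group[symmetric]) auto
  also have "\<dots> = (\<Sum>L\<in>?T. \<Sum>w\<in>rgf_words_doubles n k L. monom 1 (ls_word w))"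
    unfolding W ..
  also have "\<dots> = (\<Sum>L\<in>?T. smult (\<Prod>g=1..n - k. int k - int (nth_largest L g) + int g)
         (monom 1 ((k choose 2) + (\<Sum>l\<in>L. l - 1))))"
  proof (rule sum.cong[OF refl])
    fix L assume "L \<in> ?T"
    then have L: "L \<subseteq> {1..k}" "card L = n - k" "finite L" using finite_subset by auto
    \<comment> \<open>The exponent is constant on each group, so the group contributes its
      cardinality times one monomial.\<close>
    have "(\<Sum>w\<in>rgf_words_doubles n k L. monom (1 :: int) (ls_word w)) =
      (\<Sum>w\<in>rgf_words_doubles n k L. monom 1 ((k choose 2) + (\<Sum>l\<in>L. l - 1)))"
      using ls_word_rgf_words_doubles by (intro sum.cong) auto
    also have "\<dots> = smult (int (card (rgf_words_doubles n k L)))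
        (monom 1 ((k choose 2) + (\<Sum>l\<in>L. l - 1)))"
      by (simp add: of_nat_poly)
    \<comment> \<open>Here \<open>k \<le> n\<close> turns \<open>card L = n - k\<close>, a
      subtraction of naturals, into \<open>n = k + card L\<close>.\<close>
    also have "int (card (rgf_words_doubles n k L)) = placements (int k) L"
      using L assms by (intro card_rgf_words_doubles) auto
    also have "\<dots> = (\<Prod>g=1..n - k. int k - int (nth_largest L g) + int g)"
      using placements_nth_largest[OF L(3)] L(2) by simp
    finally show "(\<Sum>w\<in>rgf_words_doubles n k L. monom 1 (ls_word w)) =
      smult (\<Prod>g=1..n - k. int k - int (nth_largest L g) + int g)
         (monom 1 ((k choose 2) + (\<Sum>l\<in>L. l - 1)))" .
  qed
  finally show ?thesis .
qed

end
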